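(* Let $n\ge1$ be an integer and $\alpha>0$. There exist constants $C_1,C_2$ depending only on $n$ and $\alpha$ such that the following holds: for every $r>0$ and every nonnegative $u\in C^3(B_r(0))$ satisfying $$\sum_{i,j=1}^n\Bigl(\delta_{ij}-\frac{u_iu_j}{1+|\nabla u|^2}\Bigr)u_{ij}=\Bigl(\frac{1}{\sqrt{1+|\nabla u|^2}}\Bigr)^{\alpha-1}\quad\text{in }B_r(0),$$ one has $$|\nabla u(0)|\le\exp\Bigl\{C_1+C_2\frac{M^2}{r^2}\Bigr\},\qquad M=\sup_{x\in B_r(0)}u(x).$$
   Context: $B_r(0)\subset\mathbb{R}^n$ is the ball of radius $r$ centered at the origin. Subscripts denote partial derivatives: $u_i=\partial u/\partial x_i$, $u_{ij}=\partial^2u/\partial x_i\partial x_j$. If $M=+\infty$ the right-hand side is understood as $+\infty$. *)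

theory Defs
  imports "HOL-Analysis.Analysis"
begin

definition partial :: "'n::finite \<Rightarrow> (real ^ 'n \<Rightarrow> real) \<Rightarrow> real ^ 'n \<Rightarrow> real" where
  "partial i u x = deriv (\<lambda>t. u (x + t *\<^sub>R axis i 1)) 0"

definition grad :: "(real ^ 'n::finite \<Rightarrow> real) \<Rightarrow> real ^ 'n \<Rightarrow> real ^ 'n" where
  "grad u x = (\<chi> i. partial i u x)"

(* For open S this is the usual class of k times continuously differentiable functions on S;
   values of u outside S are irrelevant. *)
fun Ck_on :: "nat \<Rightarrow> (real ^ 'n::finite) set \<Rightarrow> (real ^ 'n \<Rightarrow> real) \<Rightarrow> bool" where
  "Ck_on 0 S u \<longleftrightarrow> continuous_on S u"
| "Ck_on (Suc k) S u \<longleftrightarrow>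
     (\<forall>x\<in>S. u differentiable (at x)) \<and> (\<forall>i. Ck_on k S (partial i u))"

lemma partial_eq_has_derivative:
  assumes "(u has_derivative D) (at x)"
  shows "partial i u x = D (axis i 1)"
proof -
  interpret bounded_linear D
    using assms by (rule has_derivative_bounded_linear)
  have "((\<lambda>t::real. x + t *\<^sub>R axis i 1) has_derivative (\<lambda>t. t *\<^sub>R axis i 1)) (at 0)"
    by (auto intro!: derivative_eq_intros)
  then have "((\<lambda>t::real. u (x + t *\<^sub>R axis i 1)) has_derivative (\<lambda>t. D (t *\<^sub>R axis i 1))) (at 0)"
    using has_derivative_compose[of "\<lambda>t::real. x + t *\<^sub>R axis i 1" _ 0 UNIV u D] assms by simp
  then have "((\<lambda>t::real. u (x + t *\<^sub>R axis i 1)) has_field_derivative D (axis i 1)) (at 0)"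
    by (simp add: has_field_derivative_def scaleR mult_commute_abs)
  then show ?thesis
    unfolding partial_def by (rule DERIV_imp_deriv)
qed

lemma has_derivative_grad:
  assumes "u differentiable (at x)"
  shows "(u has_derivative (\<lambda>h. grad u x \<bullet> h)) (at x)"
proof -
  obtain D where D: "(u has_derivative D) (at x)"
    using assms unfolding differentiable_def by blast
  interpret bounded_linear D
    using D by (rule has_derivative_bounded_linear)
  have "D h = grad u x \<bullet> h" for h
  proof -
    have "D h = D (\<Sum>i\<in>UNIV. h $ i *\<^sub>R axis i 1)"
      using basis_expansion[of h] by (simp add: scalar_mult_eq_scaleR)
    also have "\<dots> = (\<Sum>i\<in>UNIV. h $ i * D (axis i 1))"
      by (simp add: sum scaleR)
    also have "\<dots> = grad u x \<bullet> h"
      by (simp add: inner_vec_def grad_def partial_eq_has_derivative[OF D] mult.commute)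
    finally show ?thesis .
  qed
  then have "D = (\<lambda>h. grad u x \<bullet> h)" by (rule ext)
  with D show ?thesis by simp
qed

end

theory Submission
  imports Defs
begin

text \<open>Korevaar's maximum principle argument. Write \<open>W\<^sup>2 = 1 + |Du|\<^sup>2\<close> and
  \<open>a = I - Du Du\<^sup>T / W\<^sup>2\<close>, let \<open>m = M/r + 1\<close>, \<open>c = 1/(2 r m)\<close>, and consider an interior maximum of
  \<open>\<eta> W\<close>, where \<open>\<eta> = exp (K \<phi>) - 1\<close> and \<open>\<phi> = 1/2 - |x|\<^sup>2/r\<^sup>2 + c u\<close>; this \<open>\<phi>\<close> is at least
  \<open>1/2\<close> at the origin and negative near the boundary.
  Taking the trace with \<open>a\<close> of the Hessian of \<open>log (\<eta> W)\<close> and differentiating the equation in the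
  direction \<open>Du\<close>, all third derivatives cancel, the squared second derivatives have a good sign, and
  one is left with
  \<open>c F + K |D\<phi>|\<^sub>a\<^sup>2 - (2/r\<^sup>2) tr a \<le> (1 - \<alpha>) F Du\<cdot>D\<phi> / W\<^sup>2\<close>, where \<open>F = W powr (1 - \<alpha>)\<close>.
  Since \<open>\<phi>\<close> increases with \<open>u\<close>, the terms with \<open>F\<close> contribute \<open>\<alpha> c F\<close> with a good sign up to lower
  order, so that for \<open>K = 64 n m\<^sup>2\<close> the inequality fails as soon as \<open>W \<ge> A m\<close> with \<open>A = A(\<alpha>)\<close>.
  Hence \<open>W \<le> A m\<close> at the maximum, and comparing with the origin gives
  \<open>W(0) \<le> 2 A m exp (K/2)\<close>.\<close>

subsection \<open>Directional and mixed derivatives\<close>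

text \<open>If \<open>l\<close> were positive, \<open>f'\<close> would vanish at \<open>a\<close>
  and be positive just to its right, so \<open>f\<close> would strictly increase there and exceed
  \<open>f a\<close>.\<close>

lemma local_max_second_derivative:
  fixes f f' :: "real \<Rightarrow> real"
  assumes f: "\<forall>\<^sub>F t in nhds a. (f has_real_derivative f' t) (at t)"
    and f': "(f' has_real_derivative l) (at a)"
    and max: "\<forall>\<^sub>F t in nhds a. f t \<le> f a"
  shows "f' a = 0" "l \<le> 0"
proof -
  obtain d where d: "d > 0" and der: "\<And>t. dist t a < d \<Longrightarrow> (f has_real_derivative f' t) (at t)"
    and le: "\<And>t. dist t a < d \<Longrightarrow> f t \<le> f a"
    using eventually_conj[OF f max] unfolding eventually_nhds_metric by blast
  show crit: "f' a = 0"
    by (rule DERIV_local_max[OF der d]) (use le d in \<open>auto simp: dist_real_def abs_minus_commute\<close>)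
  show "l \<le> 0"
  proof (rule ccontr)
    assume "\<not> l \<le> 0"
    then obtain d' where d': "d' > 0" "\<And>h. 0 < h \<Longrightarrow> h < d' \<Longrightarrow> f' a < f' (a + h)"
      using DERIV_pos_inc_right[OF f'] by force
    define b where "b = min d d' / 2"
    have b: "b > 0" "b < d" "b < d'" using d d' by (auto simp: b_def)
    have "f a < f (a + b)"
    proof (rule DERIV_pos_imp_increasing_open[of a "a + b" f])
      show "\<exists>y. (f has_real_derivative y) (at t) \<and> 0 < y" if "a < t" "t < a + b" for t
        using der[of t] d'(2)[of "t - a"] that b crit by (intro exI[of _ "f' t"]) (auto simp: dist_real_def)
      show "continuous_on {a..a + b} f"
        by (rule DERIV_continuous_on[where D = f'])
          (use b in \<open>auto intro!: has_field_derivative_at_within der simp: dist_real_def\<close>)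
    qed (use b in auto)
    with le[of "a + b"] b show False by (auto simp: dist_real_def)
  qed
qed

lemma has_real_derivative_along_line:
  fixes f :: "real ^ 'n::finite \<Rightarrow> real"
  assumes "f differentiable (at (x + t *\<^sub>R e))"
  shows "((\<lambda>t. f (x + t *\<^sub>R e)) has_real_derivative (\<Sum>j\<in>UNIV. e $ j * partial j f (x + t *\<^sub>R e))) (at t)"
proof -
  have "((\<lambda>t. x + t *\<^sub>R e) has_derivative (\<lambda>h. h *\<^sub>R e)) (at t)"
    by (auto intro!: derivative_eq_intros)
  from has_derivative_compose[OF this has_derivative_grad[OF assms]]
  have "((\<lambda>t. f (x + t *\<^sub>R e)) has_derivative (\<lambda>h. grad f (x + t *\<^sub>R e) \<bullet> (h *\<^sub>R e))) (at t)" .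
  moreover have "grad f (x + t *\<^sub>R e) \<bullet> e = (\<Sum>j\<in>UNIV. e $ j * partial j f (x + t *\<^sub>R e))"
    by (simp add: inner_vec_def grad_def mult.commute)
  ultimately show ?thesis
    by (simp add: has_field_derivative_def mult_commute_abs)
qed

text \<open>Two mean value theorems: one in direction \<open>i\<close> for the difference of two
  translates of \<open>u\<close>, one in direction \<open>j\<close> for \<open>partial i u\<close>.
  The left side is symmetric in \<open>i\<close> and \<open>j\<close>, which is the source of the
  commutation of mixed partials.\<close>

lemma second_difference_mean_value:
  fixes u :: "real ^ 'n::finite \<Rightarrow> real"
  assumes u: "\<And>y. dist y x < d \<Longrightarrow> u differentiable (at y)"
    and ui: "\<And>y. dist y x < d \<Longrightarrow> partial i u differentiable (at y)"
    and h: "0 < h" "2 * h < d"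
  obtains s t where "0 < s" "s < h" "0 < t" "t < h"
    "u (x + h *\<^sub>R axis i 1 + h *\<^sub>R axis j 1) - u (x + h *\<^sub>R axis i 1)
       - u (x + h *\<^sub>R axis j 1) + u x
     = h\<^sup>2 * partial j (partial i u) (x + s *\<^sub>R axis i 1 + t *\<^sub>R axis j 1)"
proof -
  let ?i = "axis i 1 :: real ^ 'n" and ?j = "axis j 1 :: real ^ 'n"
  have near: "dist (x + s *\<^sub>R ?i + t *\<^sub>R ?j) x < d" if "0 \<le> s" "s \<le> h" "0 \<le> t" "t \<le> h" for s t
  proof -
    have "norm (s *\<^sub>R ?i + t *\<^sub>R ?j) \<le> norm (s *\<^sub>R ?i) + norm (t *\<^sub>R ?j)"
      by (rule norm_triangle_ineq)
    then show ?thesis using that h by (simp add: dist_norm norm_axis_1 add.assoc)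
  qed
  have axis_sum: "(\<Sum>k\<in>UNIV. (axis l 1 :: real ^ 'n) $ k * z k) = z l" for l z
    by (simp add: axis_def if_distrib if_distribR cong: if_cong)
  let ?F = "\<lambda>s. u (x + h *\<^sub>R ?j + s *\<^sub>R ?i) - u (x + s *\<^sub>R ?i)"
  have dF: "(?F has_real_derivative
      partial i u (x + h *\<^sub>R ?j + s *\<^sub>R ?i) - partial i u (x + s *\<^sub>R ?i)) (at s)"
    if "0 \<le> s" "s \<le> h" for s
    using has_real_derivative_along_line[of u "x + h *\<^sub>R ?j" s ?i]
      has_real_derivative_along_line[of u x s ?i] near[OF that, of h] near[OF that, of 0] h u
    unfolding axis_sum by (auto intro!: DERIV_diff simp: add_ac)
  obtain s where s: "0 < s" "s < h"
    "?F h - ?F 0 = (h - 0) * (partial i u (x + h *\<^sub>R ?j + s *\<^sub>R ?i) - partial i u (x + s *\<^sub>R ?i))"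
    using MVT2[OF h(1) dF] by blast
  have dG: "((\<lambda>t. partial i u (x + s *\<^sub>R ?i + t *\<^sub>R ?j)) has_real_derivative
      partial j (partial i u) (x + s *\<^sub>R ?i + t *\<^sub>R ?j)) (at t)"
    if "0 \<le> t" "t \<le> h" for t
    using has_real_derivative_along_line[of "partial i u" "x + s *\<^sub>R ?i" t ?j]
      near[of s t] s that ui unfolding axis_sum by auto
  obtain t where t: "0 < t" "t < h"
    "partial i u (x + s *\<^sub>R ?i + h *\<^sub>R ?j) - partial i u (x + s *\<^sub>R ?i + 0 *\<^sub>R ?j)
      = (h - 0) * partial j (partial i u) (x + s *\<^sub>R ?i + t *\<^sub>R ?j)"
    using MVT2[OF h(1) dG] by blast
  show ?thesis
    by (rule that[OF s(1,2) t(1,2)])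
      (use s(3) t(3) in \<open>simp add: add_ac power2_eq_square algebra_simps\<close>)
qed

text \<open>The second difference over a small square equals \<open>h\<close> squared times either
  mixed partial at some nearby point; continuity of both at \<open>x\<close> rules out different
  values.\<close>

lemma partial_commute:
  fixes u :: "real ^ 'n::finite \<Rightarrow> real"
  assumes "open S" "x \<in> S" and C2: "Ck_on 2 S u"
  shows "partial i (partial j u) x = partial j (partial i u) x"
proof (rule ccontr)
  let ?P = "\<lambda>i j. partial j (partial i u)"
  assume ne: "\<not> ?thesis"
  \<comment> \<open>Half the gap between the two mixed partials: a common value cannot be closer
    than this to both of them.\<close>
  define \<epsilon> where "\<epsilon> = dist (?P j i x) (?P i j x) / 2"
  have \<epsilon>: "\<epsilon> > 0" using ne by (simp add: \<epsilon>_def)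
  have diff: "u differentiable (at y)" "partial i u differentiable (at y)"
    and cont: "continuous_on S (?P i j)" if "y \<in> S" for y i j
    using C2 that by (auto simp: numeral_2_eq_2)
  have "\<forall>\<^sub>F y in nhds x. dist (?P i j y) (?P i j x) < \<epsilon> \<and> dist (?P j i y) (?P j i x) < \<epsilon> \<and> y \<in> S"
  proof -
    have "\<forall>\<^sub>F y in nhds x. dist (?P i j y) (?P i j x) < \<epsilon>" for i j
    proof -
      have "isCont (?P i j) x"
        using cont[OF \<open>x \<in> S\<close>] continuous_on_eq_continuous_at[OF \<open>open S\<close>] \<open>x \<in> S\<close> by blast
      then have "(?P i j \<longlongrightarrow> ?P i j x) (nhds x)"
        by (simp add: isCont_def tendsto_at_iff_tendsto_nhds)
      then show ?thesis using \<epsilon> by (rule tendstoD)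
    qed
    moreover have "\<forall>\<^sub>F y in nhds x. y \<in> S" using assms by (simp add: eventually_nhds_in_open)
    ultimately show ?thesis by (intro eventually_conj)
  qed
  then obtain d where d: "d > 0"
    and near: "\<And>y. dist y x < d \<Longrightarrow> dist (?P i j y) (?P i j x) < \<epsilon> \<and> dist (?P j i y) (?P j i x) < \<epsilon> \<and> y \<in> S"
    unfolding eventually_nhds_metric by blast
  define h where "h = d / 4"
  have h: "0 < h" "2 * h < d" using d by (auto simp: h_def)
  let ?i = "axis i 1 :: real ^ 'n" and ?j = "axis j 1 :: real ^ 'n"
  have close: "dist (x + s *\<^sub>R axis k 1 + t *\<^sub>R axis l 1) x < d" if "0 < s" "s < h" "0 < t" "t < h" for s t k l
  proof -
    have "norm (s *\<^sub>R axis k 1 + t *\<^sub>R axis l 1 :: real ^ 'n) \<le> norm (s *\<^sub>R axis k 1 :: real ^ 'n) + norm (t *\<^sub>R axis l 1 :: real ^ 'n)"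
      by (rule norm_triangle_ineq)
    then show ?thesis using that h by (simp add: dist_norm norm_axis_1 add.assoc)
  qed
  obtain s t where st: "0 < s" "s < h" "0 < t" "t < h"
    and st_eq: "u (x + h *\<^sub>R ?i + h *\<^sub>R ?j) - u (x + h *\<^sub>R ?i) - u (x + h *\<^sub>R ?j) + u x
     = h\<^sup>2 * ?P i j (x + s *\<^sub>R ?i + t *\<^sub>R ?j)"
    using second_difference_mean_value[of x d u i h j] near diff h by blast
  obtain s' t' where st': "0 < s'" "s' < h" "0 < t'" "t' < h"
    and st'_eq: "u (x + h *\<^sub>R ?j + h *\<^sub>R ?i) - u (x + h *\<^sub>R ?j) - u (x + h *\<^sub>R ?i) + u x
     = h\<^sup>2 * ?P j i (x + s' *\<^sub>R ?j + t' *\<^sub>R ?i)"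
    using second_difference_mean_value[of x d u j h i] near diff h by blast
  have "?P i j (x + s *\<^sub>R ?i + t *\<^sub>R ?j) = ?P j i (x + s' *\<^sub>R ?j + t' *\<^sub>R ?i)"
  proof -
    have "h\<^sup>2 * ?P i j (x + s *\<^sub>R ?i + t *\<^sub>R ?j) = h\<^sup>2 * ?P j i (x + s' *\<^sub>R ?j + t' *\<^sub>R ?i)"
      unfolding st_eq[symmetric] st'_eq[symmetric] by (simp add: add_ac)
    then show ?thesis using h by simp
  qed
  moreover have "dist (?P i j (x + s *\<^sub>R ?i + t *\<^sub>R ?j)) (?P i j x) < \<epsilon>"
    using near[OF close[OF st, of i j]] by blast
  moreover have "dist (?P j i (x + s' *\<^sub>R ?j + t' *\<^sub>R ?i)) (?P j i x) < \<epsilon>"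
    using near[OF close[OF st', of j i]] by blast
  ultimately have "dist (?P j i x) (?P i j x) < dist (?P j i x) (?P i j x)"
    unfolding \<epsilon>_def by (metis dist_triangle_half_r)
  then show False by simp
qed

text \<open>Turns neighbourhood statements in the space into statements about small
  \<open>t\<close>, as the one-variable test requires.\<close>

lemma eventually_along_line:
  assumes "\<forall>\<^sub>F y in nhds x. P y"
  shows "\<forall>\<^sub>F t in nhds (0::real). P (x + t *\<^sub>R (e :: 'a :: real_normed_vector))"
proof -
  have "isCont (\<lambda>t. x + t *\<^sub>R e) (0::real)" by (intro continuous_intros)
  then have "((\<lambda>t. x + t *\<^sub>R e) \<longlongrightarrow> x) (nhds (0::real))"
    using tendsto_at_iff_tendsto_nhds[of "\<lambda>t. x + t *\<^sub>R e" "0::real"] by (simp add: isCont_def)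
  with assms show ?thesis unfolding filterlim_iff by blast
qed

text \<open>Mixed partials are known to commute only on \<open>S\<close>, not as functions on the
  whole space, so rewriting under an outer \<open>partial\<close> relies on this locality.\<close>

lemma partial_cong_open:
  assumes "open S" "x \<in> S" "\<And>y. y \<in> S \<Longrightarrow> u y = v y"
  shows "partial i u x = partial i v x"
  unfolding partial_def
proof (rule deriv_cong_ev[OF _ refl])
  have "\<forall>\<^sub>F t in nhds (0::real). x + t *\<^sub>R axis i 1 \<in> S"
    by (rule eventually_along_line) (use assms in \<open>simp add: eventually_nhds_in_open\<close>)
  then show "\<forall>\<^sub>F t in nhds (0::real). u (x + t *\<^sub>R axis i 1) = v (x + t *\<^sub>R axis i 1)"
    by eventually_elim (use assms in auto)
qed

lemma Ck_on_Suc_imp: "Ck_on (Suc k) S u \<Longrightarrow> Ck_on k S u"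
proof (induction k arbitrary: u)
  case 0
  then show ?case
    by (auto intro!: continuous_at_imp_continuous_on differentiable_imp_continuous_within)
next
  case (Suc k)
  from Suc.prems show ?case
    by (subst Ck_on.simps(2)) (auto intro: Suc.IH simp del: Ck_on.simps(2) dest: Ck_on.simps(2)[THEN iffD1])
qed

text \<open>Two swaps move the outermost direction \<open>k\<close> innermost. The derivative of the
  Hessian along Du then has the form in which third derivatives occur in the Hessian of |Du|^2, so
  that the two can cancel.\<close>

lemma third_partials_commute:
  fixes u :: "real ^ 'n::finite \<Rightarrow> real"
  assumes S: "open S" "x \<in> S" and C3: "Ck_on 3 S u"
  shows "partial k (partial i (partial j u)) x = partial i (partial j (partial k u)) x"
proof -
  have C2: "Ck_on 2 S (partial i u)" "Ck_on 2 S u" for i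
    using C3 Ck_on_Suc_imp[of 2 S u] by (simp_all add: numeral_3_eq_3 numeral_2_eq_2)
  have "partial k (partial i (partial j u)) x = partial i (partial k (partial j u)) x"
    by (rule partial_commute[OF S C2(1)])
  also have "\<dots> = partial i (partial j (partial k u)) x"
    by (rule partial_cong_open[OF S partial_commute[OF S(1) _ C2(2)]])
  finally show ?thesis .
qed

subsection \<open>The coefficient matrix of the mean curvature operator\<close>

text \<open>The matrix \<open>H\<close> is left free because the same trace is taken of the Hessian
  of u, of its derivative along Du, of rank-one matrices and of products of Hessians.\<close>

definition mc_trace :: "real ^ 'n::finite \<Rightarrow> ('n \<Rightarrow> 'n \<Rightarrow> real) \<Rightarrow> real" where
  "mc_trace p H = (\<Sum>i\<in>UNIV. \<Sum>j\<in>UNIV.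
     ((if i = j then 1 else 0) - p $ i * p $ j / (1 + (norm p)\<^sup>2)) * H i j)"

lemma norm_sq_vec: "(norm (p :: real ^ 'n::finite))\<^sup>2 = (\<Sum>i\<in>UNIV. (p $ i)\<^sup>2)"
  unfolding power2_norm_eq_inner by (simp add: inner_vec_def power2_eq_square)

lemma mc_trace_add: "mc_trace p (\<lambda>i j. H i j + G i j) = mc_trace p H + mc_trace p G"
  by (simp add: mc_trace_def distrib_left sum.distrib)

lemma mc_trace_diff: "mc_trace p (\<lambda>i j. H i j - G i j) = mc_trace p H - mc_trace p G"
  by (simp add: mc_trace_def right_diff_distrib sum_subtractf)

lemma mc_trace_cmult: "mc_trace p (\<lambda>i j. c * H i j) = c * mc_trace p H"
  by (simp add: mc_trace_def sum_distrib_left algebra_simps)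

lemma mc_trace_divide: "mc_trace p (\<lambda>i j. H i j / c) = mc_trace p H / c"
  using mc_trace_cmult[of p "inverse c" H] by (simp add: divide_inverse mult.commute)

lemma mc_trace_sum: "mc_trace p (\<lambda>i j. \<Sum>k\<in>K. H k i j) = (\<Sum>k\<in>K. mc_trace p (H k))"
  by (induction K rule: infinite_finite_induct) (simp_all add: mc_trace_add, simp_all add: mc_trace_def)

lemma mc_trace_eq:
  "mc_trace p H = (\<Sum>i\<in>UNIV. H i i) - (\<Sum>i\<in>UNIV. \<Sum>j\<in>UNIV. p $ i * p $ j * H i j) / (1 + (norm p)\<^sup>2)"
proof -
  have "mc_trace p H = (\<Sum>i\<in>UNIV. \<Sum>j\<in>UNIV. (if i = j then H i j else 0) - p $ i * p $ j * H i j / (1 + (norm p)\<^sup>2))"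
    unfolding mc_trace_def by (intro sum.cong refl) (auto simp: algebra_simps)
  then show ?thesis by (simp add: sum_subtractf sum_divide_distrib)
qed

text \<open>The coefficient matrix \<open>I - p p\<^sup>T / W\<^sup>2\<close>, where \<open>W\<^sup>2 = 1 + |p|\<^sup>2\<close>, is the square of
  \<open>I - \<beta> p p\<^sup>T\<close> for \<open>\<beta> = 1 / (W (W + 1))\<close>.\<close>
lemma mc_trace_nonneg:
  fixes p :: "real ^ 'n::finite"
  assumes "\<And>e :: real ^ 'n. (\<Sum>i\<in>UNIV. \<Sum>j\<in>UNIV. e $ i * e $ j * H i j) \<ge> 0"
  shows "mc_trace p H \<ge> 0"
proof -
  define W where "W = sqrt (1 + (norm p)\<^sup>2)"
  define \<beta> where "\<beta> = 1 / (W * (W + 1))"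
  define S :: "'n \<Rightarrow> real ^ 'n" where "S k = (\<chi> i. (if k = i then 1 else 0) - \<beta> * p $ k * p $ i)" for k
  have W: "W \<ge> 1" and W2: "1 + (norm p)\<^sup>2 = W\<^sup>2" by (auto simp: W_def)
  \<comment> \<open>This is the coefficient of - p p^T in the square of I - \<beta> p p^T, with
    |p|^2 = W^2 - 1.\<close>
  have "2 * \<beta> - \<beta>\<^sup>2 * (W\<^sup>2 - 1) = 1 / W\<^sup>2"
  proof -
    have "2 * \<beta> * (W\<^sup>2 * (W + 1)\<^sup>2) = 2 * (W * (W + 1))"
      using W by (simp add: \<beta>_def power2_eq_square)
    moreover have "\<beta>\<^sup>2 * (W\<^sup>2 - 1) * (W\<^sup>2 * (W + 1)\<^sup>2) = W\<^sup>2 - 1"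
      using W by (simp add: \<beta>_def power_divide power_mult_distrib)
    ultimately have "(2 * \<beta> - \<beta>\<^sup>2 * (W\<^sup>2 - 1)) * (W\<^sup>2 * (W + 1)\<^sup>2) = (W + 1)\<^sup>2"
      by (simp add: algebra_simps power2_eq_square)
    then have "(2 * \<beta> - \<beta>\<^sup>2 * (W\<^sup>2 - 1)) * W\<^sup>2 = 1" using W
      by (metis (no_types, lifting) add_nonneg_eq_0_iff mult.assoc mult_cancel_right2 not_one_le_zero
          order_trans power2_eq_square zero_le_one mult_eq_0_iff)
    then show ?thesis using W by (simp add: field_simps)
  qed
  then have \<beta>: "2 * \<beta> - \<beta>\<^sup>2 * (norm p)\<^sup>2 = 1 / W\<^sup>2"
    unfolding W2[symmetric] by simp
  have S: "(\<Sum>k\<in>UNIV. S k $ i * S k $ j) = (if i = j then 1 else 0) - p $ i * p $ j / (1 + (norm p)\<^sup>2)" for i j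
  proof -
    have "(\<Sum>k\<in>UNIV. S k $ i * S k $ j) = (\<Sum>k\<in>UNIV. (if k = i then if k = j then 1 else 0 else 0)
        - (if k = i then \<beta> * p $ k * p $ j else 0) - (if k = j then \<beta> * p $ k * p $ i else 0)
        + \<beta>\<^sup>2 * p $ i * p $ j * (p $ k)\<^sup>2)"
      by (intro sum.cong refl) (auto simp: S_def algebra_simps power2_eq_square)
    also have "\<dots> = (if i = j then 1 else 0) - p $ i * p $ j * (2 * \<beta> - \<beta>\<^sup>2 * (norm p)\<^sup>2)"
      by (simp add: sum.distrib sum_subtractf sum_distrib_left[symmetric] norm_sq_vec algebra_simps)
    finally show ?thesis unfolding \<beta> W2 by simp
  qed
  \<comment> \<open>With the coefficient matrix written as the sum of the S_k S_k^T, the trace is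
    the sum of the values of the quadratic form of \<open>H\<close> at the vectors
    \<open>S k\<close>.\<close>
  have "mc_trace p H = (\<Sum>i\<in>UNIV. \<Sum>j\<in>UNIV. \<Sum>k\<in>UNIV. S k $ i * S k $ j * H i j)"
    unfolding mc_trace_def S[symmetric] by (simp add: sum_distrib_right)
  also have "\<dots> = (\<Sum>i\<in>UNIV. \<Sum>k\<in>UNIV. \<Sum>j\<in>UNIV. S k $ i * S k $ j * H i j)"
    by (intro sum.cong refl sum.swap)
  also have "\<dots> = (\<Sum>k\<in>UNIV. \<Sum>i\<in>UNIV. \<Sum>j\<in>UNIV. S k $ i * S k $ j * H i j)"
    by (rule sum.swap)
  also have "\<dots> \<ge> 0" by (intro sum_nonneg assms)
  finally show ?thesis .
qed

lemma quadratic_form_rank_one: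
  "(\<Sum>i\<in>UNIV. \<Sum>j\<in>UNIV. e $ i * e $ j * (z $ i * z $ j)) = ((e :: real ^ 'n::finite) \<bullet> z)\<^sup>2"
  by (simp add: inner_vec_def power2_eq_square sum_product mult_ac)

text \<open>This is the squared length |z|_a^2 in the metric of the coefficient matrix a.\<close>

lemma mc_trace_rank_one:
  "mc_trace p (\<lambda>i j. z $ i * z $ j) = (norm z)\<^sup>2 - (p \<bullet> z)\<^sup>2 / (1 + (norm p)\<^sup>2)"
  unfolding mc_trace_eq quadratic_form_rank_one by (simp add: norm_sq_vec[of z] power2_eq_square[of "z $ _"])

lemma mc_trace_rank_one_nonneg: "mc_trace p (\<lambda>i j. z $ i * z $ j) \<ge> 0"
  by (rule mc_trace_nonneg) (simp add: quadratic_form_rank_one)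

lemma mc_trace_diagonal_le: "mc_trace (p :: real ^ 'n::finite) (\<lambda>i j. if i = j then 1 else 0) \<le> real CARD('n)"
proof -
  have "(\<Sum>i\<in>UNIV. \<Sum>j\<in>UNIV. p $ i * p $ j * (if i = j then 1 else 0)) = (norm p)\<^sup>2"
    by (simp add: norm_sq_vec[of p] power2_eq_square[of "p $ _"] if_distrib cong: if_cong)
  then show ?thesis unfolding mc_trace_eq by simp
qed

text \<open>The matrix C = B^T a B is positive semidefinite, so the trace of a C is nonnegative. The
  ordinary trace of C is the trace of a B B^T, and p^T C p = |q|_a^2 because q = B p. The gain
  |q|_a^2 / W^2 is just enough to cancel the squared second derivatives later.\<close>

lemma mc_trace_square_ge:
  fixes p q :: "real ^ 'n::finite"
  assumes q: "\<And>i. q $ i = (\<Sum>k\<in>UNIV. p $ k * B i k)"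
  shows "mc_trace p (\<lambda>i j. \<Sum>k\<in>UNIV. B i k * B j k) \<ge> mc_trace p (\<lambda>i j. q $ i * q $ j) / (1 + (norm p)\<^sup>2)"
proof -
  define C where "C k l = mc_trace p (\<lambda>i j. B i k * B j l)" for k l
  have C: "(\<Sum>k\<in>UNIV. \<Sum>l\<in>UNIV. e $ k * e $ l * C k l)
      = mc_trace p (\<lambda>i j. (\<Sum>k\<in>UNIV. e $ k * B i k) * (\<Sum>k\<in>UNIV. e $ k * B j k))" for e :: "real ^ 'n"
    unfolding C_def mc_trace_cmult[symmetric] mc_trace_sum[symmetric]
    by (simp add: sum_product mult_ac)
  have "mc_trace p C \<ge> 0"
  proof (rule mc_trace_nonneg)
    fix e :: "real ^ 'n"
    show "(\<Sum>k\<in>UNIV. \<Sum>l\<in>UNIV. e $ k * e $ l * C k l) \<ge> 0"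
      unfolding C using mc_trace_rank_one_nonneg[of p "\<chi> i. \<Sum>k\<in>UNIV. e $ k * B i k"] by simp
  qed
  moreover have "mc_trace p C = mc_trace p (\<lambda>i j. \<Sum>k\<in>UNIV. B i k * B j k)
      - mc_trace p (\<lambda>i j. q $ i * q $ j) / (1 + (norm p)\<^sup>2)"
    unfolding mc_trace_eq[of p C] C q mc_trace_sum by (simp add: C_def)
  ultimately show ?thesis by simp
qed

text \<open>Here \<open>B\<close> stands for the Hessian of \<open>u\<close>, \<open>T\<close> for its derivative in the direction \<open>p\<close>,
  \<open>d\<close> for the gradient of \<open>\<phi>\<close>, and \<open>\<kappa>\<close> for the derivative of \<open>log \<eta>\<close> with respect to \<open>\<phi>\<close>.\<close>
lemma trace_of_hessian_condition:
  fixes p q d :: "real ^ 'n::finite" and B T :: "'n \<Rightarrow> 'n \<Rightarrow> real"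
  defines "V \<equiv> 1 + (norm p)\<^sup>2"
  assumes sym: "\<And>i j. B i j = B j i"
    and q: "\<And>i. q $ i = (\<Sum>k\<in>UNIV. p $ k * B i k)"
    and eq: "mc_trace p B = F"
    and deq: "mc_trace p T + (\<Sum>i\<in>UNIV. \<Sum>j\<in>UNIV.
        (p $ i * p $ j * (2 * (p \<bullet> q)) / V\<^sup>2 - (q $ i * p $ j + p $ i * q $ j) / V) * B i j)
      = (1 - \<alpha>) * F * (p \<bullet> q) / V"
    and \<kappa>: "\<kappa> > 0"
    and crit: "q = - (\<kappa> * V) *\<^sub>R d"
    and hess: "\<And>e :: real ^ 'n. (\<Sum>i\<in>UNIV. \<Sum>j\<in>UNIV. e $ i * e $ j *
        (((\<Sum>k\<in>UNIV. B i k * B j k) + T i j) / V - 3 / V\<^sup>2 * (q $ i * q $ j)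
          + \<kappa> * (c * B i j - b * (if i = j then 1 else 0) + K * (d $ i * d $ j)))) \<le> 0"
    and b: "b \<ge> 0"
  shows "c * F + K * ((norm d)\<^sup>2 - (p \<bullet> d)\<^sup>2 / V) - b * real CARD('n) + (\<alpha> - 1) * F * (p \<bullet> d) / V \<le> 0"
proof -
  let ?Q = "mc_trace p (\<lambda>i j. q $ i * q $ j)"
  have V: "V > 0" by (simp add: V_def add_pos_nonneg)
  have qB: "(\<Sum>i\<in>UNIV. \<Sum>j\<in>UNIV. p $ i * q $ j * B i j) = (norm q)\<^sup>2"
    "(\<Sum>i\<in>UNIV. \<Sum>j\<in>UNIV. q $ i * p $ j * B i j) = (norm q)\<^sup>2"
    "(\<Sum>i\<in>UNIV. \<Sum>j\<in>UNIV. p $ i * p $ j * B i j) = p \<bullet> q"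
  proof -
    have *: "(\<Sum>i\<in>UNIV. \<Sum>j\<in>UNIV. z $ i * p $ j * B i j) = z \<bullet> q" for z
      by (simp add: inner_vec_def q sum_distrib_left mult_ac)
    show "(\<Sum>i\<in>UNIV. \<Sum>j\<in>UNIV. q $ i * p $ j * B i j) = (norm q)\<^sup>2"
      "(\<Sum>i\<in>UNIV. \<Sum>j\<in>UNIV. p $ i * p $ j * B i j) = p \<bullet> q"
      by (simp_all add: * power2_norm_eq_inner)
    have "(\<Sum>i\<in>UNIV. \<Sum>j\<in>UNIV. p $ i * q $ j * B i j) = (\<Sum>i\<in>UNIV. \<Sum>j\<in>UNIV. q $ i * p $ j * B i j)"
      by (subst sum.swap) (simp add: mult_ac sym)
    then show "(\<Sum>i\<in>UNIV. \<Sum>j\<in>UNIV. p $ i * q $ j * B i j) = (norm q)\<^sup>2"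
      by (simp add: * power2_norm_eq_inner)
  qed
  \<comment> \<open>Differentiating the coefficients contributes only - 2 |q|_a^2 / V, so the
    differentiated equation determines the trace of the third derivatives.\<close>
  have "(\<Sum>i\<in>UNIV. \<Sum>j\<in>UNIV.
        (p $ i * p $ j * (2 * (p \<bullet> q)) / V\<^sup>2 - (q $ i * p $ j + p $ i * q $ j) / V) * B i j)
      = (2 * (p \<bullet> q)) / V\<^sup>2 * (\<Sum>i\<in>UNIV. \<Sum>j\<in>UNIV. p $ i * p $ j * B i j)
       - ((\<Sum>i\<in>UNIV. \<Sum>j\<in>UNIV. q $ i * p $ j * B i j) + (\<Sum>i\<in>UNIV. \<Sum>j\<in>UNIV. p $ i * q $ j * B i j)) / V"
    by (simp add: sum_distrib_left sum_divide_distrib sum.distrib[symmetric] sum_subtractf[symmetric]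
        algebra_simps add_divide_distrib diff_divide_distrib)
  also have "\<dots> = - 2 * ?Q / V"
    unfolding qB mc_trace_rank_one V_def[symmetric] using V by (simp add: field_simps power2_eq_square)
  finally have T: "mc_trace p T = (1 - \<alpha>) * F * (p \<bullet> q) / V + 2 * ?Q / V"
    using deq by simp
  \<comment> \<open>The matrix in \<open>hess\<close> is negative semidefinite; positivity of the
    trace is applied to its negative.\<close>
  have "mc_trace p (\<lambda>i j. - (((\<Sum>k\<in>UNIV. B i k * B j k) + T i j) / V - 3 / V\<^sup>2 * (q $ i * q $ j)
          + \<kappa> * (c * B i j - b * (if i = j then 1 else 0) + K * (d $ i * d $ j)))) \<ge> 0"
    using hess unfolding mult_minus_right sum_negf by (intro mc_trace_nonneg) (simp only: mult_minus_right sum_negf neg_0_le_iff_le)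
  moreover have "mc_trace p (\<lambda>i j. - (((\<Sum>k\<in>UNIV. B i k * B j k) + T i j) / V - 3 / V\<^sup>2 * (q $ i * q $ j)
          + \<kappa> * (c * B i j - b * (if i = j then 1 else 0) + K * (d $ i * d $ j))))
      = - ((mc_trace p (\<lambda>i j. \<Sum>k\<in>UNIV. B i k * B j k) + mc_trace p T) / V - 3 / V\<^sup>2 * ?Q
          + \<kappa> * (c * F - b * mc_trace p (\<lambda>i j. if i = j then 1 else 0) + K * mc_trace p (\<lambda>i j. d $ i * d $ j)))"
    using mc_trace_cmult[of p "- 1"] unfolding mc_trace_add mc_trace_diff mc_trace_divide mc_trace_cmult eq[symmetric]
    by (simp add: mc_trace_add mc_trace_diff mc_trace_divide mc_trace_cmult)
  ultimately have main: "(mc_trace p (\<lambda>i j. \<Sum>k\<in>UNIV. B i k * B j k) + mc_trace p T) / V - 3 / V\<^sup>2 * ?Q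
      + \<kappa> * (c * F - b * mc_trace p (\<lambda>i j. if i = j then 1 else 0) + K * mc_trace p (\<lambda>i j. d $ i * d $ j)) \<le> 0"
    by linarith
  have "?Q / V \<le> mc_trace p (\<lambda>i j. \<Sum>k\<in>UNIV. B i k * B j k)"
    unfolding V_def by (rule mc_trace_square_ge[OF q])
  then have "(?Q / V + mc_trace p T) / V \<le> (mc_trace p (\<lambda>i j. \<Sum>k\<in>UNIV. B i k * B j k) + mc_trace p T) / V"
    using V by (intro divide_right_mono) auto
  \<comment> \<open>The squared Hessian gives |q|_a^2 / V and the third derivatives give 2 |q|_a^2 /
    V, exactly balancing the term with factor 3. Only the right-hand side of the differentiated
    equation survives.\<close>
  moreover have "(?Q / V + mc_trace p T) / V - 3 / V\<^sup>2 * ?Q = (1 - \<alpha>) * F * (p \<bullet> q) / V\<^sup>2"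
    unfolding T using V by (simp add: field_simps power2_eq_square)
  \<comment> \<open>Criticality makes this remainder a multiple of \<open>\<kappa>\<close> too, so
    that \<open>\<kappa>\<close> can be divided out at the end.\<close>
  moreover have "(1 - \<alpha>) * F * (p \<bullet> q) / V\<^sup>2 = \<kappa> * ((\<alpha> - 1) * F * (p \<bullet> d) / V)"
    unfolding crit using V by (simp add: field_simps power2_eq_square)
  moreover have "b * mc_trace p (\<lambda>i j. if i = j then 1 else 0) \<le> b * real CARD('n)"
    using mc_trace_diagonal_le b by (rule mult_left_mono)
  then have "\<kappa> * (c * F - b * real CARD('n) + K * mc_trace p (\<lambda>i j. d $ i * d $ j))
    \<le> \<kappa> * (c * F - b * mc_trace p (\<lambda>i j. if i = j then 1 else 0) + K * mc_trace p (\<lambda>i j. d $ i * d $ j))"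
    using \<kappa> by (intro mult_left_mono) auto
  ultimately have "\<kappa> * ((\<alpha> - 1) * F * (p \<bullet> d) / V) + \<kappa> * (c * F - b * real CARD('n) + K * mc_trace p (\<lambda>i j. d $ i * d $ j)) \<le> 0"
    using main by linarith
  then have "\<kappa> * ((\<alpha> - 1) * F * (p \<bullet> d) / V + (c * F - b * real CARD('n) + K * mc_trace p (\<lambda>i j. d $ i * d $ j))) \<le> 0"
    by (simp add: distrib_left)
  then show ?thesis
    using \<kappa> unfolding mult_le_0_iff mc_trace_rank_one V_def[symmetric] by auto
qed

subsection \<open>The maximum principle\<close>

text \<open>Second derivative test for the logarithm of eta sqrt V along a line. Since eta = exp (K
  phi) - 1 satisfies eta'' = K eta' in phi, the second derivative of log eta is
  \<open>\<kappa>\<close> (phi2 + K phi1^2) - (\<open>\<kappa>\<close> phi1)^2. The first-order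
  condition turns the last square into V1^2 / (4 V^2), which joins V1^2 / (2 V^2) from log sqrt V to
  give the factor 3/4.\<close>

lemma log_product_line_test:
  fixes V \<phi> V1 \<phi>1 :: "real \<Rightarrow> real"
  assumes V: "\<forall>\<^sub>F t in nhds 0. (V has_real_derivative V1 t) (at t)"
    and V1: "(V1 has_real_derivative V2) (at 0)"
    and \<phi>: "\<forall>\<^sub>F t in nhds 0. (\<phi> has_real_derivative \<phi>1 t) (at t)"
    and \<phi>1: "(\<phi>1 has_real_derivative \<phi>2) (at 0)"
    and pos: "V 0 > 0" "\<phi> 0 > 0" "K > 0"
    and max: "\<forall>\<^sub>F t in nhds 0. (exp (K * \<phi> t) - 1) * sqrt (V t) \<le> (exp (K * \<phi> 0) - 1) * sqrt (V 0)"
  defines "\<kappa> \<equiv> K * exp (K * \<phi> 0) / (exp (K * \<phi> 0) - 1)"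
  shows "\<kappa> * \<phi>1 0 = - V1 0 / (2 * V 0)"
    and "V2 / (2 * V 0) - 3 / 4 * (V1 0)\<^sup>2 / (V 0)\<^sup>2 + \<kappa> * (\<phi>2 + K * (\<phi>1 0)\<^sup>2) \<le> 0"
proof -
  define L where "L t = ln (exp (K * \<phi> t) - 1) + ln (V t) / 2" for t
  define L1 where "L1 t = K * exp (K * \<phi> t) * \<phi>1 t / (exp (K * \<phi> t) - 1) + V1 t / (2 * V t)" for t
  have dV: "(V has_real_derivative V1 0) (at 0)" and d\<phi>: "(\<phi> has_real_derivative \<phi>1 0) (at 0)"
    using eventually_nhds_x_imp_x[OF V] eventually_nhds_x_imp_x[OF \<phi>] by auto
  have "\<forall>\<^sub>F t in nhds 0. V t > 0" "\<forall>\<^sub>F t in nhds 0. \<phi> t > 0"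
    using DERIV_isCont[OF dV] DERIV_isCont[OF d\<phi>] pos
    by (auto simp: isCont_def tendsto_at_iff_tendsto_nhds intro: order_tendstoD)
  note ev = this
  have "\<forall>\<^sub>F t in nhds 0. (L has_real_derivative L1 t) (at t)"
    using V \<phi> ev
  proof eventually_elim
    case (elim t)
    have "exp (K * \<phi> t) > 1" using elim pos by simp
    then show ?case unfolding L_def L1_def
      by (auto intro!: derivative_eq_intros elim simp: elim field_simps)
  qed
  moreover have "\<forall>\<^sub>F t in nhds 0. L t \<le> L 0"
    using max ev
  proof eventually_elim
    case (elim t)
    have e: "exp (K * \<phi> t) > 1" "exp (K * \<phi> 0) > 1" using elim pos by simp_all
    have *: "L s = ln ((exp (K * \<phi> s) - 1) * sqrt (V s))" if "exp (K * \<phi> s) > 1" "V s > 0" for s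
      using that by (auto simp: L_def ln_mult ln_sqrt)
    show ?case using elim pos e by (subst (1 2) *) (auto intro!: ln_mono)
  qed
  moreover
  define E where "E = exp (K * \<phi> 0)"
  have E: "E > 1" using pos by (simp add: E_def)
  have "(L1 has_real_derivative
      K * (K * \<phi>1 0 * E * \<phi>1 0 + E * \<phi>2) / (E - 1) - K * E * \<phi>1 0 * (K * \<phi>1 0 * E) / (E - 1)\<^sup>2
      + (V2 / (2 * V 0) - (V1 0)\<^sup>2 / (2 * (V 0)\<^sup>2))) (at 0)"
  proof -
    have dE: "((\<lambda>t. exp (K * \<phi> t)) has_real_derivative K * \<phi>1 0 * E) (at 0)"
      unfolding E_def by (auto intro!: derivative_eq_intros d\<phi>)
    have dE1: "((\<lambda>t. exp (K * \<phi> t) - 1) has_real_derivative K * \<phi>1 0 * E) (at 0)"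
      using DERIV_diff[OF dE DERIV_const[of 1]] by simp
    have dn: "((\<lambda>t. K * exp (K * \<phi> t) * \<phi>1 t) has_real_derivative K * (K * \<phi>1 0 * E * \<phi>1 0 + E * \<phi>2)) (at 0)"
      by (auto intro!: derivative_eq_intros dE d\<phi> \<phi>1 simp: E_def algebra_simps)
    have dV2: "((\<lambda>t. 2 * V t) has_real_derivative 2 * V1 0) (at 0)"
      by (auto intro!: derivative_eq_intros dV)
    have quotient: "(m * z - w * m') / (z * z) = m / z - w * m' / z\<^sup>2" if "z \<noteq> 0" for m w m' z :: real
      using that by (simp add: diff_divide_distrib power2_eq_square)
    show ?thesis
      unfolding L1_def
      by (rule DERIV_cong[OF DERIV_add[OF DERIV_divide[OF dn dE1] DERIV_divide[OF V1 dV2]]])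
        (use E pos in \<open>simp_all add: quotient E_def[symmetric] power_mult_distrib\<close>,
         simp add: power2_eq_square field_simps)
  qed
  ultimately have L: "L1 0 = 0"
    "K * (K * \<phi>1 0 * E * \<phi>1 0 + E * \<phi>2) / (E - 1) - K * E * \<phi>1 0 * (K * \<phi>1 0 * E) / (E - 1)\<^sup>2
      + (V2 / (2 * V 0) - (V1 0)\<^sup>2 / (2 * (V 0)\<^sup>2)) \<le> 0"
    using local_max_second_derivative by blast+
  have \<kappa>: "\<kappa> = K * E / (E - 1)" by (simp add: \<kappa>_def E_def)
  show crit: "\<kappa> * \<phi>1 0 = - V1 0 / (2 * V 0)"
    using L(1) by (simp add: L1_def \<kappa> E_def)
  have "(\<kappa> * \<phi>1 0)\<^sup>2 = (V1 0)\<^sup>2 / (4 * (V 0)\<^sup>2)"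
    unfolding crit by (simp add: power_divide power_mult_distrib)
  moreover have "K * (K * \<phi>1 0 * E * \<phi>1 0 + E * \<phi>2) / (E - 1) - K * E * \<phi>1 0 * (K * \<phi>1 0 * E) / (E - 1)\<^sup>2
     = \<kappa> * (\<phi>2 + K * (\<phi>1 0)\<^sup>2) - (\<kappa> * \<phi>1 0)\<^sup>2"
    unfolding \<kappa> using E by (simp add: divide_simps) (simp add: algebra_simps power2_eq_square)
  ultimately show "V2 / (2 * V 0) - 3 / 4 * (V1 0)\<^sup>2 / (V 0)\<^sup>2 + \<kappa> * (\<phi>2 + K * (\<phi>1 0)\<^sup>2) \<le> 0"
    using L(2) by simp
qed

text \<open>Passes from calculus to the algebra of \<open>trace_of_hessian_condition\<close>: the
  line test in every direction \<open>e\<close> yields criticality and the semidefinite Hessian, and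
  differentiating the equation along Du at \<open>x\<close> controls the third derivatives.\<close>

lemma condition_at_maximum:
  fixes u :: "real ^ 'n::finite \<Rightarrow> real" and c b K a \<alpha> :: real
  defines "\<phi> \<equiv> \<lambda>x. a - b / 2 * (norm x)\<^sup>2 + c * u x"
    and "V \<equiv> \<lambda>x. 1 + (norm (grad u x))\<^sup>2"
  assumes S: "open S" "x \<in> S" and C3: "Ck_on 3 S u"
    and pde: "\<And>y. y \<in> S \<Longrightarrow> mc_trace (grad u y) (\<lambda>i j. partial i (partial j u) y)
          = (1 / sqrt (V y)) powr (\<alpha> - 1)"
    and K: "K > 0" and b: "b \<ge> 0" and \<phi>pos: "\<phi> x > 0"
    and max: "\<forall>\<^sub>F y in nhds x. (exp (K * \<phi> y) - 1) * sqrt (V y) \<le> (exp (K * \<phi> x) - 1) * sqrt (V x)"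
  defines "p \<equiv> grad u x"
  defines "d \<equiv> c *\<^sub>R p - b *\<^sub>R x"
  defines "F \<equiv> (1 / sqrt (V x)) powr (\<alpha> - 1)"
  shows "c * F + K * ((norm d)\<^sup>2 - (p \<bullet> d)\<^sup>2 / V x) - b * real CARD('n) + (\<alpha> - 1) * F * (p \<bullet> d) / V x \<le> 0"
proof -
  have C2: "Ck_on 2 S u"
    using Ck_on_Suc_imp[of 2 S u] C3 by simp
  have diff: "u differentiable (at y)" "partial i u differentiable (at y)"
    "partial i (partial j u) differentiable (at y)" if "y \<in> S" for y i j
    using C3 that by (auto simp: numeral_3_eq_3)
  have V0: "V y > 0" for y by (simp add: V_def add_pos_nonneg)
  have V_sum: "V y = 1 + (\<Sum>k\<in>UNIV. (partial k u y)\<^sup>2)" for y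
    by (simp add: V_def norm_sq_vec grad_def)
  define B where "B i j = partial i (partial j u) x" for i j
  define q :: "real ^ 'n" where "q = (\<chi> i. \<Sum>k\<in>UNIV. p $ k * B i k)"
  define T where "T i j = (\<Sum>k\<in>UNIV. p $ k * partial i (partial j (partial k u)) x)" for i j
  define \<kappa> where "\<kappa> = K * exp (K * \<phi> x) / (exp (K * \<phi> x) - 1)"
  have p: "p $ k = partial k u x" for k by (simp add: p_def grad_def)
  have sym: "B i j = B j i" for i j
    unfolding B_def by (rule partial_commute[OF S C2])
  have in_S: "\<forall>\<^sub>F t in nhds (0::real). x + t *\<^sub>R e \<in> S" for e
    by (rule eventually_along_line) (use S in \<open>simp add: eventually_nhds_in_open\<close>)

  let ?y = "\<lambda>e t. x + t *\<^sub>R e"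
  define D where "D e f t = (\<Sum>j\<in>UNIV. e $ j * partial j f (?y e t))" for e :: "real ^ 'n" and f t
  have D: "((\<lambda>t. f (?y e t)) has_real_derivative D e f t) (at t)" if "f differentiable (at (?y e t))" for f e t
    unfolding D_def using that by (rule has_real_derivative_along_line)
  define V1 where "V1 e t = 2 * (\<Sum>k\<in>UNIV. partial k u (?y e t) * D e (partial k u) t)" for e t
  have dV: "((\<lambda>t. V (?y e t)) has_real_derivative V1 e t) (at t)" if "?y e t \<in> S" for e t
    unfolding V_sum V1_def using that
    by (auto intro!: derivative_eq_intros D diff simp: sum_distrib_left mult_ac)
  \<comment> \<open>Thus \<open>q\<close> is half the gradient of \<open>V\<close> at
    \<open>x\<close>.\<close>
  have V1_0: "V1 e 0 = 2 * (e \<bullet> q)" for e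
  proof -
    have "(\<Sum>k\<in>UNIV. partial k u x * (\<Sum>j\<in>UNIV. e $ j * B j k)) = e \<bullet> q"
      unfolding q_def inner_vec_def sum_distrib_left
      by (subst sum.swap) (simp add: p sum_distrib_left mult_ac)
    then show ?thesis by (simp add: V1_def D_def B_def)
  qed

  \<comment> \<open>Both sides of the equation, restricted to the line through \<open>x\<close> in
    direction \<open>p\<close>, agree for small \<open>t\<close>, so their derivatives at 0
    coincide.\<close>
  have deq: "mc_trace p T + (\<Sum>i\<in>UNIV. \<Sum>j\<in>UNIV.
        (p $ i * p $ j * (2 * (p \<bullet> q)) / (V x)\<^sup>2 - (q $ i * p $ j + p $ i * q $ j) / V x) * B i j)
      = (1 - \<alpha>) * F * (p \<bullet> q) / V x"
  proof -
    let ?l = "\<lambda>t. \<Sum>i\<in>UNIV. \<Sum>j\<in>UNIV. ((if i = j then 1 else 0)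
        - partial i u (?y p t) * partial j u (?y p t) / V (?y p t)) * partial i (partial j u) (?y p t)"
    let ?r = "\<lambda>t. exp ((1 - \<alpha>) / 2 * ln (V (?y p t)))"
    have F_exp: "(1 / sqrt (V y)) powr (\<alpha> - 1) = exp ((1 - \<alpha>) / 2 * ln (V y))" for y
      using V0[of y] by (simp add: powr_def ln_div ln_sqrt field_simps)
    have Du: "D p (partial i u) 0 = q $ i" for i
      by (simp add: D_def q_def B_def[symmetric] sym[of i])
    have Duu: "D p (partial i (partial j u)) 0 = T i j" for i j
      unfolding D_def T_def by (simp add: third_partials_commute[OF S C3, of _ i j])
    have dl: "(?l has_real_derivative (\<Sum>i\<in>UNIV. \<Sum>j\<in>UNIV.
        ((p $ i * p $ j * (2 * (p \<bullet> q)) / (V x)\<^sup>2 - (q $ i * p $ j + p $ i * q $ j) / V x) * B i j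
         + T i j * ((if i = j then 1 else 0) - p $ i * p $ j / V x)))) (at 0)"
    proof (intro DERIV_sum)
      fix i j
      have du: "((\<lambda>t. partial i u (?y p t)) has_real_derivative q $ i) (at 0)" for i
        unfolding Du[symmetric] by (rule D) (simp add: diff S)
      have duu: "((\<lambda>t. partial i (partial j u) (?y p t)) has_real_derivative T i j) (at 0)"
        unfolding Duu[symmetric] by (rule D) (simp add: diff S)
      have dV0: "((\<lambda>t. V (?y p t)) has_real_derivative 2 * (p \<bullet> q)) (at 0)"
        unfolding V1_0[symmetric] by (rule dV) (simp add: S)
      show "((\<lambda>t. ((if i = j then 1 else 0)
        - partial i u (?y p t) * partial j u (?y p t) / V (?y p t)) * partial i (partial j u) (?y p t)) has_real_derivative
        ((p $ i * p $ j * (2 * (p \<bullet> q)) / (V x)\<^sup>2 - (q $ i * p $ j + p $ i * q $ j) / V x) * B i j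
         + T i j * ((if i = j then 1 else 0) - p $ i * p $ j / V x))) (at 0)"
        by (rule DERIV_cong[OF DERIV_mult[OF DERIV_diff[OF DERIV_const
              DERIV_divide[OF DERIV_mult[OF du du] dV0]] duu]])
          (use V0[of x] in \<open>simp_all add: p B_def field_simps power2_eq_square\<close>)
    qed
    have dr: "(?r has_real_derivative (1 - \<alpha>) * F * (p \<bullet> q) / V x) (at 0)"
      using V0[of x] dV[where e = p and t = 0] S unfolding F_def F_exp
      by (auto intro!: derivative_eq_intros simp: V1_0)
    have "\<forall>\<^sub>F t in nhds 0. ?l t = ?r t"
      using in_S[of p]
    proof eventually_elim
      case (elim t)
      then show ?case using pde[OF elim, unfolded F_exp] by (simp add: mc_trace_def V_def grad_def)
    qed
    from DERIV_cong_ev[OF refl this refl] dr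
    have "(?l has_real_derivative (1 - \<alpha>) * F * (p \<bullet> q) / V x) (at 0)" by (rule iffD2)
    from DERIV_unique[OF this dl] show ?thesis
      by (simp add: mc_trace_def V_def p_def sum.distrib mult.commute add.commute)
  qed

  have line: "\<kappa> * (e \<bullet> d) = - (e \<bullet> q) / V x \<and>
      ((\<Sum>k\<in>UNIV. (\<Sum>j\<in>UNIV. e $ j * B j k)\<^sup>2 + p $ k * (\<Sum>j\<in>UNIV. e $ j * (\<Sum>i\<in>UNIV. e $ i * partial i (partial j (partial k u)) x)))) / V x
        - 3 / (V x)\<^sup>2 * (e \<bullet> q)\<^sup>2
        + \<kappa> * (c * (\<Sum>j\<in>UNIV. e $ j * (\<Sum>i\<in>UNIV. e $ i * B i j)) - b * (e \<bullet> e) + K * (e \<bullet> d)\<^sup>2) \<le> 0" for e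
  proof -
    \<comment> \<open>Differentiating the sum of the squares u_k^2 twice along \<open>e\<close>
      gives squares of second derivatives plus u_k times third derivatives.\<close>
    let ?V2 = "2 * (\<Sum>k\<in>UNIV. (\<Sum>j\<in>UNIV. e $ j * B j k)\<^sup>2 + p $ k * (\<Sum>j\<in>UNIV. e $ j * (\<Sum>i\<in>UNIV. e $ i * partial i (partial j (partial k u)) x)))"
    define \<phi>1 where "\<phi>1 t = c * D e u t - b * (e \<bullet> ?y e t)" for t
    have \<phi>1_0: "\<phi>1 0 = e \<bullet> d"
      by (simp add: \<phi>1_def D_def d_def inner_diff_right p[symmetric]) (simp add: inner_vec_def)
    have dD: "(D e f has_real_derivative (\<Sum>j\<in>UNIV. e $ j * (\<Sum>i\<in>UNIV. e $ i * partial i (partial j f) x))) (at 0)"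
      if "\<And>j. partial j f differentiable (at x)" for f
    proof -
      have "((\<lambda>t. partial j f (?y e t)) has_real_derivative (\<Sum>i\<in>UNIV. e $ i * partial i (partial j f) x)) (at 0)" for j
        using D[where f = "partial j f" and e = e and t = 0] that by (simp add: D_def)
      then show ?thesis unfolding D_def[abs_def] by (intro DERIV_sum DERIV_cmult)
    qed
    have dV1: "(V1 e has_real_derivative ?V2) (at 0)"
    proof -
      have "((\<lambda>t. partial k u (?y e t)) has_real_derivative (\<Sum>j\<in>UNIV. e $ j * B j k)) (at 0)" for k
        using D[where f = "partial k u" and e = e and t = 0] diff S by (simp add: D_def B_def)
      moreover have "(D e (partial k u) has_real_derivative
          (\<Sum>j\<in>UNIV. e $ j * (\<Sum>i\<in>UNIV. e $ i * partial i (partial j (partial k u)) x))) (at 0)" for k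
        using diff S by (intro dD) auto
      moreover have "D e (partial k u) 0 = (\<Sum>j\<in>UNIV. e $ j * B j k)" for k
        by (simp add: D_def B_def)
      ultimately show ?thesis unfolding V1_def[abs_def]
        by (auto intro!: derivative_eq_intros sum.cong simp: p power2_eq_square)
    qed
    have d\<phi>: "((\<lambda>t. \<phi> (?y e t)) has_real_derivative \<phi>1 t) (at t)" if "?y e t \<in> S" for t
      unfolding \<phi>_def \<phi>1_def power2_norm_eq_inner using that
      by (auto intro!: derivative_eq_intros D diff simp: inner_commute algebra_simps)
    have d\<phi>1: "(\<phi>1 has_real_derivative c * (\<Sum>j\<in>UNIV. e $ j * (\<Sum>i\<in>UNIV. e $ i * B i j)) - b * (e \<bullet> e)) (at 0)"
      unfolding \<phi>1_def[abs_def] B_def inner_add_right inner_scaleR_right using diff S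
      by (auto intro!: derivative_eq_intros dD)
    have ev: "\<forall>\<^sub>F t in nhds 0. ((\<lambda>t. V (?y e t)) has_real_derivative V1 e t) (at t)"
      "\<forall>\<^sub>F t in nhds 0. ((\<lambda>t. \<phi> (?y e t)) has_real_derivative \<phi>1 t) (at t)"
      using in_S[of e] by (auto elim!: eventually_mono intro: dV d\<phi>)
    have max': "\<forall>\<^sub>F t in nhds 0. (exp (K * \<phi> (?y e t)) - 1) * sqrt (V (?y e t)) \<le> (exp (K * \<phi> (?y e 0)) - 1) * sqrt (V (?y e 0))"
      using eventually_along_line[OF max, of e] by simp
    note test = log_product_line_test[OF ev(1) dV1 ev(2) d\<phi>1 _ _ K max']
    show ?thesis
    proof
      show "\<kappa> * (e \<bullet> d) = - (e \<bullet> q) / V x"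
        using test(1) V0[of x] \<phi>pos by (simp add: \<kappa>_def \<phi>1_0 V1_0)
      show "(\<Sum>k\<in>UNIV. (\<Sum>j\<in>UNIV. e $ j * B j k)\<^sup>2 + p $ k * (\<Sum>j\<in>UNIV. e $ j * (\<Sum>i\<in>UNIV. e $ i * partial i (partial j (partial k u)) x))) / V x
        - 3 / (V x)\<^sup>2 * (e \<bullet> q)\<^sup>2
        + \<kappa> * (c * (\<Sum>j\<in>UNIV. e $ j * (\<Sum>i\<in>UNIV. e $ i * B i j)) - b * (e \<bullet> e) + K * (e \<bullet> d)\<^sup>2) \<le> 0"
        using test(2) V0[of x] \<phi>pos by (simp add: \<kappa>_def \<phi>1_0 V1_0 power_mult_distrib)
    qed
  qed

  have \<kappa>0: "\<kappa> > 0" using K \<phi>pos by (simp add: \<kappa>_def)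
  show ?thesis unfolding V_def p_def[symmetric]
  proof (rule trace_of_hessian_condition[where B = B and T = T and q = q and \<kappa> = \<kappa>])
    show "mc_trace p B = F" using pde[OF S(2)] by (simp add: F_def p_def B_def[abs_def])
    show "q = - (\<kappa> * (1 + (norm p)\<^sup>2)) *\<^sub>R d"
    proof -
      \<comment> \<open>The first-order condition holds against every \<open>e\<close>, hence as a
        vector identity.\<close>
      have "e \<bullet> q = e \<bullet> (- (\<kappa> * V x) *\<^sub>R d)" for e
        using line[of e] V0[of x] by (simp add: field_simps)
      then have "q = - (\<kappa> * V x) *\<^sub>R d" using vector_eq_ldot by blast
      then show ?thesis by (simp add: V_def p_def)
    qed
    fix e :: "real ^ 'n"
    have e1: "(\<Sum>k\<in>UNIV. (\<Sum>j\<in>UNIV. e $ j * B j k)\<^sup>2) = (\<Sum>i\<in>UNIV. \<Sum>j\<in>UNIV. e $ i * e $ j * (\<Sum>k\<in>UNIV. B i k * B j k))"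
    proof -
      have "(\<Sum>k\<in>UNIV. (\<Sum>j\<in>UNIV. e $ j * B j k)\<^sup>2) = (\<Sum>k\<in>UNIV. \<Sum>i\<in>UNIV. \<Sum>j\<in>UNIV. e $ i * e $ j * (B i k * B j k))"
        by (simp add: power2_eq_square sum_product mult_ac)
      also have "\<dots> = (\<Sum>i\<in>UNIV. \<Sum>k\<in>UNIV. \<Sum>j\<in>UNIV. e $ i * e $ j * (B i k * B j k))"
        by (rule sum.swap)
      also have "\<dots> = (\<Sum>i\<in>UNIV. \<Sum>j\<in>UNIV. \<Sum>k\<in>UNIV. e $ i * e $ j * (B i k * B j k))"
        by (intro sum.cong refl sum.swap)
      finally show ?thesis by (simp add: sum_distrib_left)
    qed
    have e2: "(\<Sum>k\<in>UNIV. p $ k * (\<Sum>j\<in>UNIV. e $ j * (\<Sum>i\<in>UNIV. e $ i * partial i (partial j (partial k u)) x)))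
        = (\<Sum>i\<in>UNIV. \<Sum>j\<in>UNIV. e $ i * e $ j * T i j)"
    proof -
      have "(\<Sum>k\<in>UNIV. p $ k * (\<Sum>j\<in>UNIV. e $ j * (\<Sum>i\<in>UNIV. e $ i * partial i (partial j (partial k u)) x)))
          = (\<Sum>k\<in>UNIV. \<Sum>j\<in>UNIV. \<Sum>i\<in>UNIV. e $ i * e $ j * (p $ k * partial i (partial j (partial k u)) x))"
        by (simp add: sum_distrib_left mult_ac)
      also have "\<dots> = (\<Sum>j\<in>UNIV. \<Sum>k\<in>UNIV. \<Sum>i\<in>UNIV. e $ i * e $ j * (p $ k * partial i (partial j (partial k u)) x))"
        by (rule sum.swap)
      also have "\<dots> = (\<Sum>j\<in>UNIV. \<Sum>i\<in>UNIV. \<Sum>k\<in>UNIV. e $ i * e $ j * (p $ k * partial i (partial j (partial k u)) x))"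
        by (intro sum.cong refl sum.swap)
      also have "\<dots> = (\<Sum>i\<in>UNIV. \<Sum>j\<in>UNIV. \<Sum>k\<in>UNIV. e $ i * e $ j * (p $ k * partial i (partial j (partial k u)) x))"
        by (rule sum.swap)
      finally show ?thesis by (simp add: T_def sum_distrib_left)
    qed
    have e3: "(\<Sum>j\<in>UNIV. e $ j * (\<Sum>i\<in>UNIV. e $ i * B i j)) = (\<Sum>i\<in>UNIV. \<Sum>j\<in>UNIV. e $ i * e $ j * B i j)"
      unfolding sum_distrib_left by (subst sum.swap) (simp add: mult_ac)
    have e4: "e \<bullet> e = (\<Sum>i\<in>UNIV. \<Sum>j\<in>UNIV. e $ i * e $ j * (if i = j then 1 else 0))"
      by (simp add: inner_vec_def if_distrib cong: if_cong)
    \<comment> \<open>Regroups the directional inequality as a single quadratic form in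
      \<open>e\<close>.\<close>
    have "(\<Sum>i\<in>UNIV. \<Sum>j\<in>UNIV. e $ i * e $ j *
        (((\<Sum>k\<in>UNIV. B i k * B j k) + T i j) / V x - 3 / (V x)\<^sup>2 * (q $ i * q $ j)
          + \<kappa> * (c * B i j - b * (if i = j then 1 else 0) + K * (d $ i * d $ j))))
      = ((\<Sum>k\<in>UNIV. (\<Sum>j\<in>UNIV. e $ j * B j k)\<^sup>2 + p $ k * (\<Sum>j\<in>UNIV. e $ j * (\<Sum>i\<in>UNIV. e $ i * partial i (partial j (partial k u)) x)))) / V x
        - 3 / (V x)\<^sup>2 * (e \<bullet> q)\<^sup>2
        + \<kappa> * (c * (\<Sum>j\<in>UNIV. e $ j * (\<Sum>i\<in>UNIV. e $ i * B i j)) - b * (e \<bullet> e) + K * (e \<bullet> d)\<^sup>2)"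
    proof -
      have *: "z * ((v + w) / V x - s * qq + \<kappa> * (c * g - b * h + K * dd))
          = z * v / V x + z * w / V x - s * (z * qq) + (\<kappa> * (c * (z * g)) - \<kappa> * (b * (z * h)) + \<kappa> * (K * (z * dd)))"
        for z v w s qq g h dd
        by (simp add: algebra_simps add_divide_distrib)
      show ?thesis
        unfolding sum.distrib e1 e2 e3 e4 * sum_subtractf sum_distrib_left[symmetric] sum_divide_distrib[symmetric]
          quadratic_form_rank_one
        by (simp only: distrib_left right_diff_distrib add_divide_distrib)
    qed
    then show "(\<Sum>i\<in>UNIV. \<Sum>j\<in>UNIV. e $ i * e $ j *
        (((\<Sum>k\<in>UNIV. B i k * B j k) + T i j) / (1 + (norm p)\<^sup>2) - 3 / (1 + (norm p)\<^sup>2)\<^sup>2 * (q $ i * q $ j)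
          + \<kappa> * (c * B i j - b * (if i = j then 1 else 0) + K * (d $ i * d $ j)))) \<le> 0"
      using line[of e] by (simp add: V_def p_def)
  qed (use sym \<kappa>0 b deq in \<open>auto simp: q_def V_def p_def\<close>)
qed

section \<open>Choice of the constants and the resulting gradient bound\<close>

text \<open>Two separate lower bounds. First, K |d|_a^2 exceeds \<open>b * N\<close>, the 32 in
  \<open>large\<close> controlling the cross term of p and x. Second, the terms with
  \<open>F\<close> combine to F / V times c + \<alpha> c (V - 1) - (\<alpha> - 1) s, where the other
  summand in \<open>large\<close> lets the \<alpha> term dominate s.\<close>

lemma condition_fails_for_large_slope:
  fixes p x d :: "'a :: real_inner" and \<alpha> m r N F :: real
  defines "V \<equiv> 1 + (norm p)\<^sup>2" and "c \<equiv> 1 / (2 * r * m)" and "b \<equiv> 2 / r\<^sup>2" and "K \<equiv> 64 * N * m\<^sup>2"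
  assumes \<alpha>: "\<alpha> > 0" and m: "m \<ge> 1" and r: "r > 0" and x: "norm x \<le> r" and N: "N > 0" and F: "F > 0"
    and d: "d = c *\<^sub>R p - b *\<^sub>R x"
    and large: "(32 + 8 * (1 + \<alpha>) / \<alpha>) * m \<le> sqrt V"
  shows "0 < c * F + K * ((norm d)\<^sup>2 - (p \<bullet> d)\<^sup>2 / V) - b * N + (\<alpha> - 1) * F * (p \<bullet> d) / V"
proof -
  define W where "W = sqrt V"
  define y where "y = b *\<^sub>R x"
  define s where "s = p \<bullet> y"
  have VW: "V = W\<^sup>2" and p2: "(norm p)\<^sup>2 = V - 1" by (simp_all add: W_def V_def)
  have c: "c > 0" using r m by (simp add: c_def)
  have W1: "32 * m \<le> W" and W2: "8 * (1 + \<alpha>) / \<alpha> * m \<le> W"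
  proof -
    have "8 * (1 + \<alpha>) / \<alpha> * m \<ge> 0" using m \<alpha> by simp
    moreover have "32 * m + 8 * (1 + \<alpha>) / \<alpha> * m \<le> W" using large by (simp only: W_def distrib_right)
    ultimately show "32 * m \<le> W" "8 * (1 + \<alpha>) / \<alpha> * m \<le> W" using m by linarith+
  qed
  have W: "W \<ge> 32" using W1 m by linarith
  have V: "V \<ge> 2" "V > 0"
  proof -
    have "2 * 1 \<le> W * W" using W by (intro mult_mono) auto
    then show "V \<ge> 2" unfolding VW by (simp add: power2_eq_square)
    then show "V > 0" by simp
  qed
  have y: "norm y \<le> 2 / r"
  proof -
    have "norm y \<le> b * r" using x r by (simp add: y_def b_def mult_left_mono divide_right_mono)
    then show ?thesis using r by (simp add: b_def power2_eq_square)
  qed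
  have pW: "norm p \<le> W" unfolding W_def V_def by (rule real_le_rsqrt) simp
  have s: "\<bar>s\<bar> \<le> W * (2 / r)"
    unfolding s_def using Cauchy_Schwarz_ineq2[of p y] mult_mono[OF pW y] W by force
  have s2: "s\<^sup>2 \<le> V * (norm y)\<^sup>2"
  proof -
    have "s\<^sup>2 \<le> (norm p)\<^sup>2 * (norm y)\<^sup>2"
      unfolding s_def power_mult_distrib[symmetric] by (rule power2_le_iff_abs_le[THEN iffD2]) (simp_all add: Cauchy_Schwarz_ineq2)
    also have "\<dots> \<le> V * (norm y)\<^sup>2" by (intro mult_right_mono) (simp_all add: V_def)
    finally show ?thesis .
  qed
  have pd: "p \<bullet> d = c * (V - 1) - s"
    unfolding d y_def[symmetric] by (simp add: inner_diff_right s_def p2[symmetric] power2_norm_eq_inner)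
  have d2: "(norm d)\<^sup>2 = c\<^sup>2 * (V - 1) - 2 * c * s + (norm y)\<^sup>2"
  proof -
    have "(norm d)\<^sup>2 = c\<^sup>2 * (norm p)\<^sup>2 - 2 * c * s + (norm y)\<^sup>2"
      unfolding d y_def[symmetric] s_def power2_norm_eq_inner
      by (simp add: inner_diff_left inner_diff_right inner_commute power2_eq_square algebra_simps)
    then show ?thesis unfolding p2 .
  qed
  have "(norm d)\<^sup>2 - (p \<bullet> d)\<^sup>2 / V = c\<^sup>2 * (1 - 1 / V) - 2 * c * (s / V) + ((norm y)\<^sup>2 - s\<^sup>2 / V)"
    unfolding pd d2 using V by (simp add: field_simps power2_eq_square)
  moreover have "(norm y)\<^sup>2 - s\<^sup>2 / V \<ge> 0"
    using s2 V by (simp add: field_simps)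
  moreover have "c\<^sup>2 * (1 - 1 / V) \<ge> c\<^sup>2 * (1 / 2)"
    using V by (intro mult_left_mono) (simp_all add: field_simps)
  \<comment> \<open>From |s| \<le> 2 W / r and W >= 32 m one gets s / V \<le> 2 / (32 r m) = c / 8,
    so half of the leading c^2 / 2 survives the cross term.\<close>
  moreover have "2 * c * (s / V) \<le> c\<^sup>2 / 4"
  proof -
    have "s / V \<le> W * (2 / r) / V" using s V by (intro divide_right_mono) auto
    also have "\<dots> = 2 / (r * W)" using W unfolding VW by (simp add: field_simps power2_eq_square)
    also have "\<dots> \<le> 2 / (r * (32 * m))"
      using W1 r m by (intro divide_left_mono mult_left_mono mult_pos_pos) auto
    also have "\<dots> = c / 8" by (simp add: c_def)
    finally have "2 * c * (s / V) \<le> 2 * c * (c / 8)" using c by (intro mult_left_mono) auto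
    then show ?thesis by (simp add: power2_eq_square)
  qed
  ultimately have "(norm d)\<^sup>2 - (p \<bullet> d)\<^sup>2 / V \<ge> c\<^sup>2 / 4" by linarith
  then have "K * ((norm d)\<^sup>2 - (p \<bullet> d)\<^sup>2 / V) \<ge> K * (c\<^sup>2 / 4)"
    using N by (intro mult_left_mono) (auto simp: K_def)
  \<comment> \<open>The factor 64 in \<open>K\<close> makes this twice \<open>b * N\<close>, leaving
    a strict surplus.\<close>
  moreover have "K * (c\<^sup>2 / 4) = 2 * (b * N)"
    using m r by (simp add: K_def c_def b_def power_divide power_mult_distrib)
  moreover have "b * N > 0" using N r by (simp add: b_def)
  ultimately have 1: "K * ((norm d)\<^sup>2 - (p \<bullet> d)\<^sup>2 / V) - b * N > 0" by linarith
  have "0 \<le> c + \<alpha> * c * (V - 1) - (\<alpha> - 1) * s"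
  proof -
    have "(\<alpha> - 1) * s \<le> \<bar>\<alpha> - 1\<bar> * \<bar>s\<bar>" by (metis abs_ge_self abs_mult)
    also have "\<dots> \<le> (1 + \<alpha>) * (W * (2 / r))" using s \<alpha> by (intro mult_mono) auto
    \<comment> \<open>The second summand in \<open>large\<close> is tuned so that its product with
      \<alpha> c / 2 is 2 (1 + \<alpha>) / r.\<close>
    also have "\<dots> = W * (\<alpha> * c / 2 * (8 * (1 + \<alpha>) / \<alpha> * m))"
      using \<alpha> m r by (simp add: c_def field_simps)
    also have "\<dots> \<le> W * (\<alpha> * c / 2 * W)"
      using W2 W c \<alpha> by (intro mult_left_mono) auto
    also have "\<dots> = \<alpha> * c * (V / 2)" by (simp add: VW power2_eq_square)
    also have "\<dots> \<le> \<alpha> * c * (V - 1)" using c \<alpha> V by (intro mult_left_mono) auto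
    finally show ?thesis using c by linarith
  qed
  then have "0 \<le> F / V * (c + \<alpha> * c * (V - 1) - (\<alpha> - 1) * s)"
    using F V by (intro mult_nonneg_nonneg) auto
  also have "\<dots> = c * F + (\<alpha> - 1) * F * (p \<bullet> d) / V"
    unfolding pd using V by (simp add: field_simps)
  finally show ?thesis using 1 by linarith
qed

text \<open>Maximises eta W over a smaller closed ball on whose boundary phi \<le> 0. Positivity at
  the origin then forces an interior maximum, so the behaviour of \<open>u\<close> up to the sphere
  of radius \<open>r\<close> never enters.\<close>

lemma interior_gradient_bound:
  fixes u :: "real ^ 'n::finite \<Rightarrow> real" and \<alpha> r M :: real
  defines "m \<equiv> M / r + 1"
  assumes \<alpha>: "\<alpha> > 0" and r: "r > 0" and C3: "Ck_on 3 (ball 0 r) u"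
    and u: "\<And>x. x \<in> ball 0 r \<Longrightarrow> 0 \<le> u x" "\<And>x. x \<in> ball 0 r \<Longrightarrow> u x \<le> M"
    and pde: "\<And>x. x \<in> ball 0 r \<Longrightarrow> mc_trace (grad u x) (\<lambda>i j. partial i (partial j u) x)
          = (1 / sqrt (1 + (norm (grad u x))\<^sup>2)) powr (\<alpha> - 1)"
  shows "norm (grad u 0) \<le> 2 * (32 + 8 * (1 + \<alpha>) / \<alpha>) * m * exp (32 * real CARD('n) * m\<^sup>2)"
proof -
  define A where "A = 32 + 8 * (1 + \<alpha>) / \<alpha>"
  define c where "c = 1 / (2 * r * m)"
  define b where "b = 2 / r\<^sup>2"
  define K where "K = 64 * real CARD('n) * m\<^sup>2"
  define \<phi> where "\<phi> x = 1 / 2 - b / 2 * (norm x)\<^sup>2 + c * u x" for x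
  define V where "V x = 1 + (norm (grad u x))\<^sup>2" for x
  define G where "G x = (exp (K * \<phi> x) - 1) * sqrt (V x)" for x
  \<comment> \<open>Chosen so that phi \<le> \<open>\<theta>\<close> - |x|^2 / r^2, a bound
    vanishing on the sphere of radius \<open>\<rho>\<close>. By the choice of \<open>c\<close>, c M
    = M / (2 (M + r)) < 1/2, so \<open>\<theta>\<close> < 1 and \<open>\<rho>\<close> < r.\<close>
  define \<theta> where "\<theta> = 1 / 2 + c * M"
  define \<rho> where "\<rho> = r * sqrt \<theta>"
  have M: "M \<ge> 0" using u[of 0] r by force
  have m: "m \<ge> 1" using M r by (simp add: m_def)
  have c: "c > 0" and b: "b > 0" and K: "K > 0" using r m by (simp_all add: c_def b_def K_def)
  have \<theta>: "1 / 2 \<le> \<theta>" "\<theta> < 1"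
  proof -
    show "1 / 2 \<le> \<theta>" using c M by (simp add: \<theta>_def)
    have "2 * r * m = 2 * (M + r)" using r by (simp add: m_def field_simps)
    then show "\<theta> < 1" using M r by (simp add: \<theta>_def c_def field_simps)
  qed
  have \<rho>: "\<rho> > 0" "\<rho> < r" using \<theta> r by (simp_all add: \<rho>_def)
  have \<phi>_le: "\<phi> x \<le> \<theta> - (norm x)\<^sup>2 / r\<^sup>2" if "x \<in> ball 0 r" for x
    using mult_left_mono[OF u(2)[OF that], of c] c by (simp add: \<phi>_def \<theta>_def b_def)
  have diff: "u differentiable (at x)" "partial i u differentiable (at x)" if "x \<in> ball 0 r" for x i
    using C3 that by (auto simp: numeral_3_eq_3)
  have V_sum: "V = (\<lambda>x. 1 + (\<Sum>k\<in>UNIV. (partial k u x)\<^sup>2))"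
    by (simp add: V_def norm_sq_vec grad_def fun_eq_iff)
  have "continuous_on (cball 0 \<rho>) G"
    unfolding G_def[abs_def] \<phi>_def V_sum
    using \<rho> diff by (intro continuous_intros continuous_at_imp_continuous_on ballI differentiable_imp_continuous_within) auto
  then obtain x0 where x0: "x0 \<in> cball 0 \<rho>" and max: "\<And>y. y \<in> cball 0 \<rho> \<Longrightarrow> G y \<le> G x0"
    using continuous_attains_sup[of "cball 0 \<rho>" G] \<rho> by (auto simp: compact_cball)
  have V0: "V x > 0" for x by (simp add: V_def add_pos_nonneg)
  have \<phi>0: "\<phi> 0 \<ge> 1 / 2" using u(1)[of 0] c r by (simp add: \<phi>_def)
  have e: "exp (K / 2) > 1" using K by simp
  have "exp (K / 2) \<le> exp (K * \<phi> 0)" using mult_left_mono[OF \<phi>0, of K] K by simp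
  then have G0: "(exp (K / 2) - 1) * sqrt (V 0) \<le> G 0"
    unfolding G_def using V0[of 0] by (intro mult_right_mono) auto
  \<comment> \<open>Positivity of \<open>G\<close> at the origin carries over to \<open>x0\<close>;
    this forces \<open>\<phi> x0 > 0\<close> and excludes the boundary sphere.\<close>
  have "0 < (exp (K / 2) - 1) * sqrt (V 0)" using V0[of 0] e by simp
  also note G0
  also have "G 0 \<le> G x0" using max[of 0] \<rho> by simp
  finally have "G x0 > 0" .
  then have \<phi>x0: "\<phi> x0 > 0" using V0[of x0] K by (simp add: G_def zero_less_mult_iff)
  have x0_ball: "x0 \<in> ball 0 r" using x0 \<rho> by simp
  have "norm x0 < \<rho>"
  proof (rule ccontr)
    assume "\<not> norm x0 < \<rho>"
    then have "norm x0 = \<rho>" using x0 by simp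
    then have "(norm x0)\<^sup>2 / r\<^sup>2 = \<theta>" using \<theta> r by (simp add: \<rho>_def power_mult_distrib)
    then show False using \<phi>_le[OF x0_ball] \<phi>x0 by simp
  qed
  then have local_max: "\<forall>\<^sub>F y in nhds x0. G y \<le> G x0"
    using eventually_nhds_in_open[of "ball 0 \<rho>" x0] by (auto elim!: eventually_mono intro: max)
  have "sqrt (V x0) < A * m"
  proof (rule ccontr)
    assume "\<not> sqrt (V x0) < A * m"
    then have large: "A * m \<le> sqrt (V x0)" by simp
    have "c * F + K * ((norm d)\<^sup>2 - (grad u x0 \<bullet> d)\<^sup>2 / V x0) - b * real CARD('n)
        + (\<alpha> - 1) * F * (grad u x0 \<bullet> d) / V x0 \<le> 0"
      if "d = c *\<^sub>R grad u x0 - b *\<^sub>R x0" "F = (1 / sqrt (V x0)) powr (\<alpha> - 1)" for d F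
      using local_max \<phi>x0 b K unfolding that G_def V_def \<phi>_def
      by (intro condition_at_maximum[OF open_ball x0_ball C3 pde]) auto
    moreover have "0 < c * F + K * ((norm d)\<^sup>2 - (grad u x0 \<bullet> d)\<^sup>2 / V x0) - b * real CARD('n)
        + (\<alpha> - 1) * F * (grad u x0 \<bullet> d) / V x0"
      if "d = c *\<^sub>R grad u x0 - b *\<^sub>R x0" "F = (1 / sqrt (V x0)) powr (\<alpha> - 1)" for d F
      unfolding c_def b_def K_def V_def
      by (rule condition_fails_for_large_slope[OF \<alpha> m r, of x0])
        (use x0_ball large that V0[of x0] in \<open>auto simp: A_def V_def c_def b_def\<close>)
    ultimately show False by (meson not_less)
  qed
  have "(exp (K / 2) - 1) * sqrt (V 0) \<le> G 0" by (rule G0)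
  also have "\<dots> \<le> G x0" using max[of 0] \<rho> by simp
  also have "\<dots> \<le> (exp K - 1) * (A * m)"
  proof -
    have "\<phi> x0 \<le> \<theta> - (norm x0)\<^sup>2 / r\<^sup>2" by (rule \<phi>_le[OF x0_ball])
    also have "\<dots> \<le> 1" using \<theta> by (simp add: add_increasing2 le_diff_eq diff_le_eq)
    finally have "K * \<phi> x0 \<le> K" using K by simp
    then show ?thesis unfolding G_def using \<open>sqrt (V x0) < A * m\<close> K V0[of x0]
      by (intro mult_mono) auto
  qed
  \<comment> \<open>Factoring exp K - 1 as a difference of squares cancels the factor at the origin
    and leaves exp (K/2) instead of exp K.\<close>
  also have "\<dots> = (exp (K / 2) - 1) * ((exp (K / 2) + 1) * (A * m))"
  proof -
    have "exp K = exp (K / 2) * exp (K / 2)" by (simp flip: exp_add)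
    then show ?thesis by (simp add: algebra_simps)
  qed
  finally have "sqrt (V 0) \<le> (exp (K / 2) + 1) * (A * m)" using e by simp
  also have "\<dots> \<le> (2 * exp (K / 2)) * (A * m)"
    using e m \<alpha> by (intro mult_right_mono) (auto simp: A_def)
  also have "\<dots> = 2 * A * m * exp (32 * real CARD('n) * m\<^sup>2)" by (simp add: K_def)
  finally have "sqrt (V 0) \<le> 2 * A * m * exp (32 * real CARD('n) * m\<^sup>2)" .
  moreover have "norm (grad u 0) \<le> sqrt (V 0)" unfolding V_def by (rule real_le_rsqrt) simp
  ultimately show ?thesis unfolding A_def by linarith
qed

theorem theorem1p4:
  fixes \<alpha> :: real
  assumes "\<alpha> > 0"
  shows "\<exists>C1 C2 :: real. \<forall>r > 0. \<forall>u :: real ^ 'n::finite \<Rightarrow> real.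
    Ck_on 3 (ball 0 r) u \<longrightarrow>
    (\<forall>x \<in> ball 0 r. u x \<ge> 0) \<longrightarrow>
    (\<forall>x \<in> ball 0 r.
       (\<Sum>i\<in>UNIV. \<Sum>j\<in>UNIV.
          ((if i = j then 1 else 0) - partial i u x * partial j u x / (1 + (norm (grad u x))\<^sup>2))
            * partial i (partial j u) x)
       = (1 / sqrt (1 + (norm (grad u x))\<^sup>2)) powr (\<alpha> - 1)) \<longrightarrow>
    (let M = (SUP x \<in> ball 0 r. ereal (u x)) in
       ereal (norm (grad u 0)) \<le>
         (if M = \<infinity> then \<infinity> else ereal (exp (C1 + C2 * (real_of_ereal M)\<^sup>2 / r\<^sup>2))))"
proof -
  define A where "A = 2 * (32 + 8 * (1 + \<alpha>) / \<alpha>)"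
  \<comment> \<open>The extra 1 absorbs the linear factor m through m \<le> exp (m^2).\<close>
  define N where "N = 32 * real CARD('n) + 1"
  have A: "A > 0" using assms by (simp add: A_def add_pos_nonneg)
  have N: "N > 0" by (simp add: N_def add_nonneg_pos)
  show ?thesis
    unfolding Let_def
  \<comment> \<open>The gradient is at most exp (ln A + N m^2), and m^2 = (M/r + 1)^2 \<le> 2 + 2
    M^2 / r^2 splits N m^2 between the two constants.\<close>
  proof (rule exI[of _ "ln A + 2 * N"], rule exI[of _ "2 * N"], intro allI impI)
    fix r :: real and u :: "real ^ 'n \<Rightarrow> real"
    assume r: "r > 0" and C3: "Ck_on 3 (ball 0 r) u" and nonneg: "\<forall>x \<in> ball 0 r. u x \<ge> 0"
      and pde: "\<forall>x \<in> ball 0 r.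
       (\<Sum>i\<in>UNIV. \<Sum>j\<in>UNIV.
          ((if i = j then 1 else 0) - partial i u x * partial j u x / (1 + (norm (grad u x))\<^sup>2))
            * partial i (partial j u) x)
       = (1 / sqrt (1 + (norm (grad u x))\<^sup>2)) powr (\<alpha> - 1)"
    let ?S = "SUP x \<in> ball 0 r. ereal (u x)"
    show "ereal (norm (grad u 0)) \<le> (if ?S = \<infinity> then \<infinity>
        else ereal (exp (ln A + 2 * N + 2 * N * (real_of_ereal ?S)\<^sup>2 / r\<^sup>2)))"
    proof (cases "?S = \<infinity>")
      case False
      define M where "M = real_of_ereal ?S"
      define m where "m = M / r + 1"
      have le: "ereal (u x) \<le> ?S" if "x \<in> ball 0 r" for x
        using that by (rule SUP_upper)
      \<comment> \<open>Nonnegativity at the centre excludes minus infinity, so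
        \<open>real_of_ereal\<close> returns the actual supremum and not its default value
        0.\<close>
      have "ereal 0 \<le> ?S" using le[of 0] nonneg r by (metis centre_in_ball ereal_less_eq(3) order_trans)
      with False have S: "?S = ereal M"
        unfolding M_def by (cases ?S) auto
      have M: "M \<ge> 0" using \<open>ereal 0 \<le> ?S\<close> S by simp
      have m: "m \<ge> 1" using M r by (simp add: m_def)
      have "norm (grad u 0) \<le> 2 * (32 + 8 * (1 + \<alpha>) / \<alpha>) * m * exp (32 * real CARD('n) * m\<^sup>2)"
        unfolding m_def
      proof (rule interior_gradient_bound[OF assms r C3])
        show "0 \<le> u x" "u x \<le> M" if "x \<in> ball 0 r" for x
          using nonneg that le[OF that] S by auto
        show "mc_trace (grad u x) (\<lambda>i j. partial i (partial j u) x)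
            = (1 / sqrt (1 + (norm (grad u x))\<^sup>2)) powr (\<alpha> - 1)" if "x \<in> ball 0 r" for x
          using pde that by (simp add: mc_trace_def grad_def)
      qed
      also have "\<dots> \<le> A * exp (m\<^sup>2) * exp (32 * real CARD('n) * m\<^sup>2)"
      proof -
        have "m \<le> m\<^sup>2" using m by (simp add: power2_eq_square)
        also have "\<dots> \<le> exp (m\<^sup>2)" using exp_ge_add_one_self[of "m\<^sup>2"] by linarith
        finally show ?thesis unfolding A_def[symmetric] using A by (intro mult_right_mono mult_left_mono) auto
      qed
      also have "\<dots> = exp (ln A + N * m\<^sup>2)"
      proof -
        have "N * m\<^sup>2 = m\<^sup>2 + 32 * real CARD('n) * m\<^sup>2" by (simp add: N_def distrib_right)
        then show ?thesis using A by (simp add: exp_add mult.assoc)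
      qed
      also have "\<dots> \<le> exp (ln A + 2 * N + 2 * N * M\<^sup>2 / r\<^sup>2)"
      proof -
        have square_le: "(z + 1)\<^sup>2 \<le> 2 + 2 * z\<^sup>2" for z :: real
          using zero_le_power2[of "z - 1"] by (simp add: power2_eq_square algebra_simps)
        have "m\<^sup>2 \<le> 2 + 2 * (M / r)\<^sup>2"
          unfolding m_def by (rule square_le)
        then have "N * m\<^sup>2 \<le> N * (2 + 2 * (M / r)\<^sup>2)" using N by (intro mult_left_mono) auto
        also have "\<dots> = 2 * N + 2 * N * M\<^sup>2 / r\<^sup>2" by (simp add: power_divide algebra_simps)
        finally show ?thesis by simp
      qed
      finally show ?thesis using False by (simp add: M_def)
    qed simp
  qed
qed

end
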